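(* Let $E$ be a real Banach space, let $P\subset E$ be a cone with $\operatorname{int}P\neq\emptyset$, and let $(X,\mathcal{S})$ be a cone $S$-metric space with $\mathcal{S}:X\times X\times X\to E$ (equivalently, an $N$-cone metric space). Let $e\in \operatorname{int}P$ and let $a\in[0,\infty)$ with $a<1$. Then there exists an $S$-metric $\mathcal{S}^{\ast}:X\times X\times X\to[0,\infty)$ which induces the same topology on $X$ as the cone $S$-metric topology induced by $\mathcal{S}$.
   Context: **Cone.** A subset $P$ of a real Banach space $E$ is a cone if: (1) $P$ is closed, nonempty and $P\neq\{0\}$; (2) if $a,b\ge 0$ are real numbers and $x,y\in P$, then $ax+by\in P$; (3) if $x\in P$ and $-x\in P$, then $x=0$. Write $x\precsim y$ if $y-x\in P$, and $x\ll y$ if $y-x\in\operatorname{int}P$, where $\operatorname{int}P$ is the interior of $P$. **Cone $S$-metric.** Let $X$ be a nonempty set and $P$ a cone in a real Banach space $E$ with $\operatorname{int}P\ne\emptyset$. A function $\mathcal{S}:X\times X\times X\to E$ is a cone $S$-metric (also called an $N$-cone metric) on $X$ if for all $x,y,z,a\in X$: (1) $0\precsim\mathcal{S}(x,y,z)$; (2) $\mathcal{S}(x,y,z)=0$ if and only if $x=y=z$; (3) $\mathcal{S}(x,y,z)\precsim\mathcal{S}(x,x,a)+\mathcal{S}(y,y,a)+\mathcal{S}(z,z,a)$. The pair $(X,\mathcal{S})$ is then called a cone $S$-metric space. The cone $S$-metric topology on $X$ is the topology whose base is the family of open balls $B_{\mathcal{S}}(x,c)=\{y\in X:\mathcal{S}(y,y,x)\ll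 c\}$, for $x\in X$ and $c\in E$ with $0\ll c$. **$S$-metric.** A function $\mathcal{S}^{\ast}:X\times X\times X\to[0,\infty)$ is an $S$-metric on $X$ if for all $x,y,z,a\in X$: (1) $\mathcal{S}^{\ast}(x,y,z)\ge 0$; (2) $\mathcal{S}^{\ast}(x,y,z)=0$ if and only if $x=y=z$; (3) $\mathcal{S}^{\ast}(x,y,z)\le\mathcal{S}^{\ast}(x,x,a)+\mathcal{S}^{\ast}(y,y,a)+\mathcal{S}^{\ast}(z,z,a)$. The topology induced by an $S$-metric is the one whose base is the family of open balls $B_{\mathcal{S}^{\ast}}(x,r)=\{y\in X:\mathcal{S}^{\ast}(y,y,x)<r\}$, for $x\in X$ and $r>0$. *)

theory Defs
  imports "HOL-Analysis.Analysis"
begin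

text \<open>Closed, pointed convex cones inducing a partial order.  The library predicate \<open>cone\<close>
  only asks for closure under nonnegative scaling.\<close>

definition order_cone :: "'e::real_normed_vector set \<Rightarrow> bool" where
  "order_cone P \<longleftrightarrow>
     closed P \<and> P \<noteq> {} \<and> P \<noteq> {0} \<and>
     (\<forall>a b :: real. \<forall>x\<in>P. \<forall>y\<in>P. 0 \<le> a \<longrightarrow> 0 \<le> b \<longrightarrow> a *\<^sub>R x + b *\<^sub>R y \<in> P) \<and>
     (\<forall>x. x \<in> P \<and> - x \<in> P \<longrightarrow> x = 0)"

definition cone_le :: "'e::real_normed_vector set \<Rightarrow> 'e \<Rightarrow> 'e \<Rightarrow> bool" where
  "cone_le P x y \<longleftrightarrow> y - x \<in> P"

definition cone_ll :: "'e::real_normed_vector set \<Rightarrow> 'e \<Rightarrow> 'e \<Rightarrow> bool" where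
  "cone_ll P x y \<longleftrightarrow> y - x \<in> interior P"

definition cone_S_metric ::
    "'x set \<Rightarrow> 'e::real_normed_vector set \<Rightarrow> ('x \<Rightarrow> 'x \<Rightarrow> 'x \<Rightarrow> 'e) \<Rightarrow> bool" where
  "cone_S_metric X P S \<longleftrightarrow>
     X \<noteq> {} \<and> order_cone P \<and> interior P \<noteq> {} \<and>
     (\<forall>x\<in>X. \<forall>y\<in>X. \<forall>z\<in>X. cone_le P 0 (S x y z)) \<and>
     (\<forall>x\<in>X. \<forall>y\<in>X. \<forall>z\<in>X. S x y z = 0 \<longleftrightarrow> x = y \<and> y = z) \<and>
     (\<forall>x\<in>X. \<forall>y\<in>X. \<forall>z\<in>X. \<forall>a\<in>X. cone_le P (S x y z) (S x x a + S y y a + S z z a))"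

definition cone_S_ball ::
    "'x set \<Rightarrow> 'e::real_normed_vector set \<Rightarrow> ('x \<Rightarrow> 'x \<Rightarrow> 'x \<Rightarrow> 'e) \<Rightarrow> 'x \<Rightarrow> 'e \<Rightarrow> 'x set" where
  "cone_S_ball X P S x c = {y \<in> X. cone_ll P (S y y x) c}"

text \<open>\<open>topology\<close> is meaningful only on families satisfying \<open>istopology\<close>; that the balls
  do form a base is \<open>openin_cone_S_topology\<close> and \<open>openin_S_topology\<close> below.\<close>

definition cone_S_topology ::
    "'x set \<Rightarrow> 'e::real_normed_vector set \<Rightarrow> ('x \<Rightarrow> 'x \<Rightarrow> 'x \<Rightarrow> 'e) \<Rightarrow> 'x topology" where
  "cone_S_topology X P S =
     topology (arbitrary union_of (\<lambda>U. U \<in> {cone_S_ball X P S x c | x c. x \<in> X \<and> cone_ll P 0 c}))"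

definition S_metric :: "'x set \<Rightarrow> ('x \<Rightarrow> 'x \<Rightarrow> 'x \<Rightarrow> real) \<Rightarrow> bool" where
  "S_metric X S \<longleftrightarrow>
     (\<forall>x\<in>X. \<forall>y\<in>X. \<forall>z\<in>X. 0 \<le> S x y z) \<and>
     (\<forall>x\<in>X. \<forall>y\<in>X. \<forall>z\<in>X. S x y z = 0 \<longleftrightarrow> x = y \<and> y = z) \<and>
     (\<forall>x\<in>X. \<forall>y\<in>X. \<forall>z\<in>X. \<forall>a\<in>X. S x y z \<le> S x x a + S y y a + S z z a)"

definition S_ball :: "'x set \<Rightarrow> ('x \<Rightarrow> 'x \<Rightarrow> 'x \<Rightarrow> real) \<Rightarrow> 'x \<Rightarrow> real \<Rightarrow> 'x set" where
  "S_ball X S x r = {y \<in> X. S y y x < r}"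

definition S_topology :: "'x set \<Rightarrow> ('x \<Rightarrow> 'x \<Rightarrow> 'x \<Rightarrow> real) \<Rightarrow> 'x topology" where
  "S_topology X S =
     topology (arbitrary union_of (\<lambda>U. U \<in> {S_ball X S x r | x r. x \<in> X \<and> 0 < r}))"

lemma order_cone_add: "order_cone P \<Longrightarrow> x \<in> P \<Longrightarrow> y \<in> P \<Longrightarrow> x + y \<in> P"
  unfolding order_cone_def by (metis scaleR_one zero_le_one)

lemma order_cone_scaleR: "order_cone P \<Longrightarrow> x \<in> P \<Longrightarrow> 0 \<le> a \<Longrightarrow> a *\<^sub>R x \<in> P"
  unfolding order_cone_def by (metis add.right_neutral order_refl scaleR_zero_left)

lemma interior_order_cone_add:
  assumes "order_cone P" "x \<in> interior P" "y \<in> P"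
  shows "x + y \<in> interior P"
proof -
  have "open ((+) y ` interior P)" by (simp add: open_translation)
  moreover have "(+) y ` interior P \<subseteq> P"
    using assms order_cone_add interior_subset by blast
  ultimately have "(+) y ` interior P \<subseteq> interior P" by (simp add: interior_maximal)
  then show ?thesis using assms(2) by (force simp: add.commute)
qed

lemma interior_order_cone_scaleR:
  assumes "order_cone P" "x \<in> interior P" "0 < a"
  shows "a *\<^sub>R x \<in> interior P"
proof -
  have "open ((*\<^sub>R) a ` interior P)" using assms(3) by (simp add: open_scaling)
  moreover have "(*\<^sub>R) a ` interior P \<subseteq> P"
  proof (intro image_subsetI)
    fix u assume "u \<in> interior P"
    then have "u \<in> P" using interior_subset by blast
    then show "a *\<^sub>R u \<in> P" using assms order_cone_scaleR[of P u a] by simp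
  qed
  ultimately have "(*\<^sub>R) a ` interior P \<subseteq> interior P" by (simp add: interior_maximal)
  then show ?thesis using assms(2) by blast
qed

lemma interior_order_cone_lower_bound:
  assumes P: "order_cone P" and d: "d1 \<in> interior P" "d2 \<in> interior P"
  shows "\<exists>d \<in> interior P. d1 - d \<in> interior P \<and> d2 - d \<in> interior P"
proof -
  have "((\<lambda>t::real. d2 - t *\<^sub>R d1) \<longlongrightarrow> d2 - 0 *\<^sub>R d1) (at_right 0)"
    by (intro tendsto_intros)
  then have "\<forall>\<^sub>F t in at_right (0::real). d2 - t *\<^sub>R d1 \<in> interior P"
    using d(2) by (intro topological_tendstoD) auto
  then obtain b :: real where b: "b > 0" "\<forall>t>0. t < b \<longrightarrow> d2 - t *\<^sub>R d1 \<in> interior P"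
    by (auto simp: eventually_at_right_field)
  define t where "t = min (b / 2) (1 / 2)"
  have t: "0 < t" "t < b" "t < 1" using b by (auto simp: t_def)
  have "d1 - t *\<^sub>R d1 = (1 - t) *\<^sub>R d1" by (simp add: algebra_simps)
  then have "d1 - t *\<^sub>R d1 \<in> interior P"
    using interior_order_cone_scaleR[OF P d(1), of "1 - t"] t by simp
  then show ?thesis using interior_order_cone_scaleR[OF P d(1) t(1)] b t by blast
qed

lemma cone_S_metric_refl: "cone_S_metric X P S \<Longrightarrow> x \<in> X \<Longrightarrow> S x x x = 0"
  by (simp add: cone_S_metric_def)

lemma cone_S_metric_triangle:
  assumes "cone_S_metric X P S" "x \<in> X" "y \<in> X" "z \<in> X" "a \<in> X"
  shows "cone_le P (S x y z) (S x x a + S y y a + S z z a)"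
  using assms by (simp add: cone_S_metric_def)

lemma cone_S_metric_sym:
  assumes S: "cone_S_metric X P S" and "x \<in> X" "y \<in> X"
  shows "S x x y = S y y x"
proof -
  have le: "S v v u - S u u v \<in> P" if "u \<in> X" "v \<in> X" for u v
  proof -
    have "cone_le P (S u u v) (S u u u + S u u u + S v v u)"
      using cone_S_metric_triangle[OF S] that by blast
    then show ?thesis using cone_S_metric_refl[OF S that(1)] by (simp add: cone_le_def)
  qed
  have "- (S y y x - S x x y) \<in> P" using le[of y x] assms by simp
  moreover have "order_cone P" using S by (simp add: cone_S_metric_def)
  ultimately have "S y y x - S x x y = 0"
    using le[of x y] assms(2,3) unfolding order_cone_def by blast
  then show ?thesis by simp
qed

lemma cone_S_ball_nested:
  assumes S: "cone_S_metric X P S" and x: "x \<in> X" and y: "y \<in> cone_S_ball X P S x c"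
  shows "\<exists>d \<in> interior P. \<forall>d'. d - d' \<in> interior P \<longrightarrow> cone_S_ball X P S y d' \<subseteq> cone_S_ball X P S x c"
proof -
  have P: "order_cone P" using S by (simp add: cone_S_metric_def)
  have yX: "y \<in> X" and yc: "c - S y y x \<in> interior P"
    using y by (auto simp: cone_S_ball_def cone_ll_def)
  define d where "d = (1/2) *\<^sub>R (c - S y y x)"
  have dP: "d \<in> interior P"
    unfolding d_def using interior_order_cone_scaleR[OF P yc] by simp
  have "cone_S_ball X P S y d' \<subseteq> cone_S_ball X P S x c" if d': "d - d' \<in> interior P" for d'
  proof
    fix z assume z: "z \<in> cone_S_ball X P S y d'"
    then have zX: "z \<in> X" and "d' - S z z y \<in> interior P"
      by (auto simp: cone_S_ball_def cone_ll_def)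
    then have "(d - d') + (d' - S z z y) \<in> interior P"
      using interior_order_cone_add[OF P d'] interior_subset by blast
    then have "2 *\<^sub>R ((d - d') + (d' - S z z y)) \<in> interior P"
      by (intro interior_order_cone_scaleR[OF P]) auto
    then have 1: "c - S y y x - 2 *\<^sub>R S z z y \<in> interior P"
      by (simp add: d_def algebra_simps)
    have "cone_le P (S z z x) (S z z y + S z z y + S x x y)"
      using cone_S_metric_triangle[OF S] zX x yX by blast
    then have "2 *\<^sub>R S z z y + S y y x - S z z x \<in> P"
      using cone_S_metric_sym[OF S x yX] by (simp add: cone_le_def scaleR_2)
    from interior_order_cone_add[OF P 1 this] have "c - S z z x \<in> interior P" by simp
    then show "z \<in> cone_S_ball X P S x c" using zX by (simp add: cone_S_ball_def cone_ll_def)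
  qed
  then show ?thesis using dP by blast
qed

lemma openin_cone_S_topology:
  assumes S: "cone_S_metric X P S"
  shows "openin (cone_S_topology X P S) =
    arbitrary union_of (\<lambda>U. U \<in> {cone_S_ball X P S x c | x c. x \<in> X \<and> cone_ll P 0 c})"
proof -
  have P: "order_cone P" using S by (simp add: cone_S_metric_def)
  have "(arbitrary union_of (\<lambda>U. U \<in> {cone_S_ball X P S x c | x c. x \<in> X \<and> cone_ll P 0 c})) (U \<inter> V)"
    if U: "U \<in> {cone_S_ball X P S x c | x c. x \<in> X \<and> cone_ll P 0 c}"
      and V: "V \<in> {cone_S_ball X P S x c | x c. x \<in> X \<and> cone_ll P 0 c}" for U V
    unfolding arbitrary_union_of_alt
  proof
    fix z assume z: "z \<in> U \<inter> V"
    obtain x c x' c' where U': "U = cone_S_ball X P S x c" "x \<in> X"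
      and V': "V = cone_S_ball X P S x' c'" "x' \<in> X"
      using U V by blast
    obtain d1 where d1: "d1 \<in> interior P"
      "\<And>d'. d1 - d' \<in> interior P \<Longrightarrow> cone_S_ball X P S z d' \<subseteq> U"
      using cone_S_ball_nested[OF S U'(2), of z c] z U' by blast
    obtain d2 where d2: "d2 \<in> interior P"
      "\<And>d'. d2 - d' \<in> interior P \<Longrightarrow> cone_S_ball X P S z d' \<subseteq> V"
      using cone_S_ball_nested[OF S V'(2), of z c'] z V' by blast
    obtain d where d: "d \<in> interior P" "d1 - d \<in> interior P" "d2 - d \<in> interior P"
      using interior_order_cone_lower_bound[OF P d1(1) d2(1)] by blast
    have zX: "z \<in> X" using z U' by (simp add: cone_S_ball_def)
    have "z \<in> cone_S_ball X P S z d"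
      using zX d(1) cone_S_metric_refl[OF S zX] by (simp add: cone_S_ball_def cone_ll_def)
    moreover have "cone_S_ball X P S z d \<subseteq> U \<inter> V" using d1(2) d2(2) d by blast
    moreover have "cone_ll P 0 d" using d(1) by (simp add: cone_ll_def)
    ultimately show "\<exists>W. W \<in> {cone_S_ball X P S x c | x c. x \<in> X \<and> cone_ll P 0 c} \<and>
        z \<in> W \<and> W \<subseteq> U \<inter> V"
      using zX by blast
  qed
  then show ?thesis
    unfolding cone_S_topology_def by (intro topology_inverse') (simp only: istopology_base_eq, blast)
qed

lemma S_metric_refl: "S_metric X S \<Longrightarrow> x \<in> X \<Longrightarrow> S x x x = 0"
  by (simp add: S_metric_def)

lemma S_metric_triangle:
  assumes "S_metric X S" "x \<in> X" "y \<in> X" "z \<in> X" "a \<in> X"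
  shows "S x y z \<le> S x x a + S y y a + S z z a"
  using assms by (simp add: S_metric_def)

lemma S_metric_sym:
  assumes S: "S_metric X S" and "x \<in> X" "y \<in> X"
  shows "S x x y = S y y x"
proof -
  have le: "S u u v \<le> S v v u" if "u \<in> X" "v \<in> X" for u v
  proof -
    have "S u u v \<le> S u u u + S u u u + S v v u"
      using S_metric_triangle[OF S] that by blast
    then show ?thesis using S_metric_refl[OF S that(1)] by simp
  qed
  show ?thesis using le[of x y] le[of y x] assms by simp
qed

lemma S_ball_nested:
  assumes S: "S_metric X S" and x: "x \<in> X" and y: "y \<in> S_ball X S x r"
  shows "\<exists>d>0. \<forall>d'\<le>d. S_ball X S y d' \<subseteq> S_ball X S x r"
proof -
  have yX: "y \<in> X" and yr: "S y y x < r" using y by (auto simp: S_ball_def)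
  have "S_ball X S y d' \<subseteq> S_ball X S x r" if d': "d' \<le> (r - S y y x) / 2" for d'
  proof
    fix z assume "z \<in> S_ball X S y d'"
    then have z: "z \<in> X" "S z z y < d'" by (auto simp: S_ball_def)
    have "S z z x \<le> S z z y + S z z y + S x x y"
      using S_metric_triangle[OF S] z x yX by blast
    then show "z \<in> S_ball X S x r"
      using S_metric_sym[OF S x yX] z d' by (simp add: S_ball_def field_simps)
  qed
  then show ?thesis using yr by (intro exI[of _ "(r - S y y x) / 2"]) auto
qed

lemma openin_S_topology:
  assumes S: "S_metric X S"
  shows "openin (S_topology X S) =
    arbitrary union_of (\<lambda>U. U \<in> {S_ball X S x r | x r. x \<in> X \<and> 0 < r})"
proof -
  have "(arbitrary union_of (\<lambda>U. U \<in> {S_ball X S x r | x r. x \<in> X \<and> 0 < r})) (U \<inter> V)"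
    if U: "U \<in> {S_ball X S x r | x r. x \<in> X \<and> 0 < r}"
      and V: "V \<in> {S_ball X S x r | x r. x \<in> X \<and> 0 < r}" for U V
    unfolding arbitrary_union_of_alt
  proof
    fix z assume z: "z \<in> U \<inter> V"
    obtain x r x' r' where U': "U = S_ball X S x r" "x \<in> X"
      and V': "V = S_ball X S x' r'" "x' \<in> X"
      using U V by blast
    obtain d1 where d1: "d1 > 0" "\<And>d'. d' \<le> d1 \<Longrightarrow> S_ball X S z d' \<subseteq> U"
      using S_ball_nested[OF S U'(2), of z r] z U' by blast
    obtain d2 where d2: "d2 > 0" "\<And>d'. d' \<le> d2 \<Longrightarrow> S_ball X S z d' \<subseteq> V"
      using S_ball_nested[OF S V'(2), of z r'] z V' by blast
    have zX: "z \<in> X" using z U' by (simp add: S_ball_def)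
    have "S z z z = 0" using S_metric_refl[OF S zX] .
    then have "z \<in> S_ball X S z (min d1 d2)"
      using zX d1(1) d2(1) by (simp add: S_ball_def)
    moreover have "S_ball X S z (min d1 d2) \<subseteq> U \<inter> V" using d1(2) d2(2) by simp
    moreover have "0 < min d1 d2" using d1(1) d2(1) by simp
    ultimately show "\<exists>W. W \<in> {S_ball X S x r | x r. x \<in> X \<and> 0 < r} \<and> z \<in> W \<and> W \<subseteq> U \<inter> V"
      using zX by blast
  qed
  then show ?thesis
    unfolding S_topology_def by (intro topology_inverse') (simp only: istopology_base_eq, blast)
qed

end

theory Submission
  imports Defs
begin

text \<open>An interior point \<open>e\<close> of the cone is an order unit, so its Minkowski functional
  \<open>u \<mapsto> inf {t \<ge> 0. u \<precsim> t e}\<close> is finite.  It is subadditive and monotone, vanishes on \<open>P\<close> only at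
  \<open>0\<close> because \<open>P\<close> is closed and pointed, and lies below \<open>r > 0\<close> exactly where \<open>u \<lless> r e\<close>.
  Composing it with \<open>S\<close> therefore gives an \<open>S\<close>-metric whose balls are the cone balls of radius
  \<open>r e\<close>; these suffice to generate the topology since every \<open>c \<ggreater> 0\<close> dominates some \<open>r e\<close>.\<close>

definition order_unit_gauge :: "'e::real_normed_vector set \<Rightarrow> 'e \<Rightarrow> 'e \<Rightarrow> real" where
  "order_unit_gauge P e u = Inf {t. 0 \<le> t \<and> cone_le P u (t *\<^sub>R e)}"

text \<open>As \<open>t\<close> decreases to 0, \<open>d - t *\<^sub>R v\<close> tends to
  \<open>d\<close>, and \<open>interior P\<close> is open. The cap \<open>r\<close> lets callers
  keep \<open>r - t\<close> positive.\<close>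

lemma interior_diff_small_scaleR:
  fixes v d :: "'e::real_normed_vector"
  assumes "d \<in> interior P" "0 < r"
  obtains t :: real where "0 < t" "t < r" "d - t *\<^sub>R v \<in> interior P"
proof -
  have "((\<lambda>t::real. d - t *\<^sub>R v) \<longlongrightarrow> d - 0 *\<^sub>R v) (at_right 0)"
    by (intro tendsto_intros)
  then have "\<forall>\<^sub>F t in at_right (0::real). d - t *\<^sub>R v \<in> interior P"
    using assms(1) by (intro topological_tendstoD) auto
  then obtain b :: real where b: "b > 0" "\<forall>t>0. t < b \<longrightarrow> d - t *\<^sub>R v \<in> interior P"
    by (auto simp: eventually_at_right_field)
  show ?thesis
    by (rule that[of "min (b / 2) (r / 2)"]) (use b assms(2) in auto)
qed

context
  fixes P :: "'e::real_normed_vector set" and e :: 'e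
  assumes P: "order_cone P" and e: "e \<in> interior P"
begin

text \<open>A small step from \<open>e\<close> in direction \<open>-u\<close> stays in
  \<open>P\<close>; rescaling \<open>e - s *\<^sub>R u\<close> by \<open>1 / s\<close> shows that
  \<open>1 / s\<close> is admissible for \<open>u\<close>.\<close>

lemma order_unit_exists: "\<exists>t\<ge>0. cone_le P u (t *\<^sub>R e)"
proof -
  obtain s :: real where s: "0 < s" "e - s *\<^sub>R u \<in> interior P"
    using interior_diff_small_scaleR[OF e zero_less_one] by blast
  then have "(1 / s) *\<^sub>R (e - s *\<^sub>R u) \<in> P"
    using order_cone_scaleR[OF P] interior_subset[of P] by auto
  with s show ?thesis
    by (intro exI[of _ "1 / s"]) (simp add: cone_le_def scaleR_diff_right)
qed

lemma order_unit_gauge_nonneg: "0 \<le> order_unit_gauge P e u"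
  unfolding order_unit_gauge_def using order_unit_exists by (intro cInf_greatest) auto

lemma order_unit_gauge_le:
  "0 \<le> t \<Longrightarrow> cone_le P u (t *\<^sub>R e) \<Longrightarrow> order_unit_gauge P e u \<le> t"
  unfolding order_unit_gauge_def by (intro cInf_lower) (auto intro: bdd_belowI[of _ 0])

lemma order_unit_gauge_lessE:
  assumes "order_unit_gauge P e u < r"
  obtains t where "0 \<le> t" "t < r" "cone_le P u (t *\<^sub>R e)"
  using cInf_lessD[OF _ assms[unfolded order_unit_gauge_def]] order_unit_exists by auto

text \<open>Strict inequality corresponds to the interior because any slack is a positive multiple
  of the interior point \<open>e\<close>. Positivity of \<open>r\<close> matters: for
  \<open>u = - e\<close> and \<open>r = 0\<close> the right side holds, while the gauge is never
  negative.\<close>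

lemma order_unit_gauge_less_iff:
  assumes "0 < r"
  shows "order_unit_gauge P e u < r \<longleftrightarrow> cone_ll P u (r *\<^sub>R e)"
proof
  assume "order_unit_gauge P e u < r"
  then obtain t where t: "t < r" "t *\<^sub>R e - u \<in> P"
    unfolding cone_le_def[symmetric] by (rule order_unit_gauge_lessE)
  \<comment> \<open>This splits \<open>r *\<^sub>R e - u\<close> into an interior point and an
    element of \<open>P\<close>.\<close>
  have "(r - t) *\<^sub>R e + (t *\<^sub>R e - u) \<in> interior P"
    using t interior_order_cone_scaleR[OF P e] by (intro interior_order_cone_add[OF P]) auto
  then show "cone_ll P u (r *\<^sub>R e)" by (simp add: cone_ll_def algebra_simps)
next
  assume "cone_ll P u (r *\<^sub>R e)"
  then obtain t where t: "0 < t" "t < r" "r *\<^sub>R e - u - t *\<^sub>R e \<in> interior P"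
    unfolding cone_ll_def by (rule interior_diff_small_scaleR[OF _ assms])
  then have "cone_le P u ((r - t) *\<^sub>R e)"
    using interior_subset[of P] by (auto simp: cone_le_def algebra_simps)
  then show "order_unit_gauge P e u < r" using order_unit_gauge_le[of "r - t" u] t by simp
qed

text \<open>If the gauge vanishes, letting \<open>t\<close> tend to 0 in
  \<open>t *\<^sub>R e - u\<close> gives \<open>- u \<in> P\<close> by closedness, and pointedness
  finishes. The restriction to \<open>P\<close> is essential, since the gauge is 0 on all of
  \<open>-P\<close>.\<close>

lemma order_unit_gauge_eq_0_iff:
  assumes "u \<in> P"
  shows "order_unit_gauge P e u = 0 \<longleftrightarrow> u = 0"
proof
  assume "order_unit_gauge P e u = 0"
  then have "t *\<^sub>R e - u \<in> P" if "0 < t" for t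
    using order_unit_gauge_less_iff[OF that, of u] that interior_subset[of P]
    by (auto simp: cone_ll_def)
  then have "\<forall>\<^sub>F t in at_right (0::real). t *\<^sub>R e - u \<in> P"
    by (auto simp: eventually_at_right_field intro: exI[of _ 1])
  moreover have "((\<lambda>t::real. t *\<^sub>R e - u) \<longlongrightarrow> 0 *\<^sub>R e - u) (at_right 0)"
    by (intro tendsto_intros)
  moreover have "closed P" using P by (simp add: order_cone_def)
  ultimately have "0 *\<^sub>R e - u \<in> P" by (intro Lim_in_closed_set) auto
  then show "u = 0" using assms P unfolding order_cone_def by simp
next
  assume "u = 0"
  then have "order_unit_gauge P e u \<le> 0"
    using order_unit_gauge_le[of 0 u] order_cone_scaleR[OF P assms, of 0]
    by (simp add: cone_le_def)
  then show "order_unit_gauge P e u = 0" using order_unit_gauge_nonneg[of u] by simp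
qed

lemma order_unit_gauge_mono:
  assumes "cone_le P u v"
  shows "order_unit_gauge P e u \<le> order_unit_gauge P e v"
\<comment> \<open>Every \<open>t\<close> admissible for \<open>v\<close> is admissible for
  \<open>u\<close>; approaching the infimum from above avoids showing that it is attained.\<close>
proof (rule dense_ge)
  fix r assume "order_unit_gauge P e v < r"
  then obtain t where t: "0 \<le> t" "t < r" "t *\<^sub>R e - v \<in> P"
    unfolding cone_le_def[symmetric] by (rule order_unit_gauge_lessE)
  then have "cone_le P u (t *\<^sub>R e)"
    using order_cone_add[OF P t(3), of "v - u"] assms by (simp add: cone_le_def)
  with t show "order_unit_gauge P e u \<le> r" using order_unit_gauge_le by force
qed

lemma order_unit_gauge_add_le:
  "order_unit_gauge P e (u + v) \<le> order_unit_gauge P e u + order_unit_gauge P e v"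
proof (rule field_le_epsilon)
  \<comment> \<open>Near-optimal bounds for \<open>u\<close> and \<open>v\<close>, each with error
    below \<open>d / 2\<close>, add up to an admissible bound for \<open>u + v\<close>.\<close>
  fix d :: real assume d: "0 < d"
  obtain s where s: "0 \<le> s" "s < order_unit_gauge P e u + d / 2" "s *\<^sub>R e - u \<in> P"
    using order_unit_gauge_lessE[of u "order_unit_gauge P e u + d / 2"] d
    by (auto simp: cone_le_def)
  obtain t where t: "0 \<le> t" "t < order_unit_gauge P e v + d / 2" "t *\<^sub>R e - v \<in> P"
    using order_unit_gauge_lessE[of v "order_unit_gauge P e v + d / 2"] d
    by (auto simp: cone_le_def)
  have "cone_le P (u + v) ((s + t) *\<^sub>R e)"
    using order_cone_add[OF P s(3) t(3)] by (simp add: cone_le_def algebra_simps)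
  then show "order_unit_gauge P e (u + v)
      \<le> order_unit_gauge P e u + order_unit_gauge P e v + d"
    using order_unit_gauge_le[of "s + t" "u + v"] s t by simp
qed

lemma S_metric_order_unit_gauge:
  assumes S: "cone_S_metric X P S"
  shows "S_metric X (\<lambda>x y z. order_unit_gauge P e (S x y z))"
  unfolding S_metric_def
proof (intro conjI ballI)
  fix x y z assume X: "x \<in> X" "y \<in> X" "z \<in> X"
  then have "S x y z \<in> P" "S x y z = 0 \<longleftrightarrow> x = y \<and> y = z"
    using S by (auto simp: cone_S_metric_def cone_le_def)
  then show "order_unit_gauge P e (S x y z) = 0 \<longleftrightarrow> x = y \<and> y = z"
    by (simp add: order_unit_gauge_eq_0_iff)
  fix a assume "a \<in> X"
  with X have "order_unit_gauge P e (S x y z)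
      \<le> order_unit_gauge P e (S x x a + S y y a + S z z a)"
    by (intro order_unit_gauge_mono cone_S_metric_triangle[OF S])
  also have "\<dots> \<le> order_unit_gauge P e (S x x a) + order_unit_gauge P e (S y y a)
      + order_unit_gauge P e (S z z a)"
    using order_unit_gauge_add_le[of "S x x a + S y y a" "S z z a"]
      order_unit_gauge_add_le[of "S x x a" "S y y a"] by simp
  finally show "order_unit_gauge P e (S x y z) \<le> order_unit_gauge P e (S x x a)
      + order_unit_gauge P e (S y y a) + order_unit_gauge P e (S z z a)" .
qed (rule order_unit_gauge_nonneg)

lemma S_ball_order_unit_gauge:
  "0 < r \<Longrightarrow> S_ball X (\<lambda>x y z. order_unit_gauge P e (S x y z)) x r
    = cone_S_ball X P S x (r *\<^sub>R e)"
  by (simp add: S_ball_def cone_S_ball_def order_unit_gauge_less_iff)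

lemma S_topology_order_unit_gauge:
  assumes S: "cone_S_metric X P S"
  shows "S_topology X (\<lambda>x y z. order_unit_gauge P e (S x y z)) = cone_S_topology X P S"
    (is "S_topology X ?S' = _")
proof -
  let ?B = "{S_ball X ?S' x r | x r. x \<in> X \<and> 0 < r}"
  let ?C = "{cone_S_ball X P S x c | x c. x \<in> X \<and> cone_ll P 0 c}"
  have "W \<in> ?C" if W: "W \<in> ?B" for W
  proof -
    obtain x r where x: "x \<in> X" "0 < r" and "W = cone_S_ball X P S x (r *\<^sub>R e)"
      using W by (auto simp: S_ball_order_unit_gauge)
    moreover have "cone_ll P 0 (r *\<^sub>R e)"
      using interior_order_cone_scaleR[OF P e x(2)] by (simp add: cone_ll_def)
    ultimately show ?thesis by blast
  qed
  \<comment> \<open>The ball is recentred at \<open>y\<close>: a cone ball around \<open>y\<close>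
    of any radius \<open>d'\<close> with \<open>d' \<lless> d\<close> fits inside \<open>W\<close>,
    and \<open>d' = r *\<^sub>R e\<close> makes it a gauge ball.\<close>
  moreover have "\<exists>V. V \<in> ?B \<and> y \<in> V \<and> V \<subseteq> W" if W: "W \<in> ?C" and y: "y \<in> W" for W y
  proof -
    obtain x c where x: "x \<in> X" and Wc: "W = cone_S_ball X P S x c"
      using W by blast
    have yX: "y \<in> X" using y Wc by (simp add: cone_S_ball_def)
    obtain d where d: "d \<in> interior P"
      "\<And>d'. d - d' \<in> interior P \<Longrightarrow> cone_S_ball X P S y d' \<subseteq> W"
      using cone_S_ball_nested[OF S x, of y c] y Wc by blast
    obtain r :: real where r: "0 < r" "d - r *\<^sub>R e \<in> interior P"
      using interior_diff_small_scaleR[OF d(1) zero_less_one] by blast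
    have "S_ball X ?S' y r \<subseteq> W" using d(2)[OF r(2)] r(1) by (simp add: S_ball_order_unit_gauge)
    moreover have "y \<in> S_ball X ?S' y r"
      using S_metric_refl[OF S_metric_order_unit_gauge[OF S] yX] yX r(1)
      by (simp add: S_ball_def)
    ultimately show ?thesis using yX r(1) by blast
  qed
  \<comment> \<open>A set is a union of base members iff each of its points lies in a base member
    inside the set, so mutual refinement of \<open>?B\<close> and \<open>?C\<close> gives the same
    open sets.\<close>
  ultimately have "(arbitrary union_of (\<lambda>U. U \<in> ?B)) U \<longleftrightarrow> (arbitrary union_of (\<lambda>U. U \<in> ?C)) U"
    for U unfolding arbitrary_union_of_alt by (meson subset_trans)
  then show ?thesis
    unfolding topology_eq openin_S_topology[OF S_metric_order_unit_gauge[OF S]]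
      openin_cone_S_topology[OF S] by blast
qed

end

theorem theorem4p1:
  fixes P :: "'e::banach set" and X :: "'x set" and S :: "'x \<Rightarrow> 'x \<Rightarrow> 'x \<Rightarrow> 'e"
    and e :: 'e and a :: real
  assumes "order_cone P" and "interior P \<noteq> {}"
    and "cone_S_metric X P S"
    and "e \<in> interior P"
    and "0 \<le> a" and "a < 1"
  shows "\<exists>S' :: 'x \<Rightarrow> 'x \<Rightarrow> 'x \<Rightarrow> real.
    S_metric X S' \<and> S_topology X S' = cone_S_topology X P S"
  using S_metric_order_unit_gauge[OF assms(1,4,3)] S_topology_order_unit_gauge[OF assms(1,4,3)]
  by blast

end
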